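(* Let $G$ be the simply connected 4-dimensional Lie group whose Lie algebra has a basis $X_1,X_2,X_3,X_4$ with $$[X_2,X_3]=[X_3,X_1]=[X_1,X_2]=0,\quad [X_1,X_4]=X_2,\quad [X_2,X_4]=0,\quad [X_3,X_4]=0 .$$ For real numbers $a_1,\dots,a_6$ let $$Y_1=X_1+a_2X_2+a_3X_3,\quad Y_2=X_2,\quad Y_3=a_1X_2+X_3,\quad Y_4=a_4X_1+a_5X_2+a_6X_3+X_4 .$$ Suppose the left-invariant metric $g_0$ on $G$ is diagonal in the basis $Y_i$, i.e. $g_0(Y_i,Y_j)=\lambda_i\delta_{ij}$ with $\lambda_i>0$. Then the Ricci flow solution $g(t)$ with $g(0)=g_0$ remains diagonal in the basis $Y_i$ for all $t\ge0$.
   Context: Elements of the Lie algebra are identified with left-invariant vector fields on $G$. The Ricci flow solution $g(t)$ is the left-invariant solution of $\frac{\partial}{\partial t}g(t)=-2\operatorname{Ric}(g(t))$, $g(0)=g_0$ (equivalently, the solution of the corresponding ODE on inner products on the Lie algebra). "Diagonal in the basis $Y_i$" means $g(t)(Y_i,Y_j)=0$ for all $i\ne j$. *)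

theory Defs
  imports "HOL-Analysis.Analysis"
begin

text \<open>
  Left-invariant Riemannian geometry on a Lie group, expressed on its Lie algebra of left-invariant
  vector fields. The Lie algebra is a real vector space \<open>'a\<close> with bracket \<open>br\<close>, and
  a left-invariant metric is an inner product on \<open>'a\<close>.
\<close>

definition lie_algebra :: "('a::real_vector \<Rightarrow> 'a \<Rightarrow> 'a) \<Rightarrow> bool" where
  "lie_algebra br \<longleftrightarrow> bilinear br \<and> (\<forall>u. br u u = 0) \<and>
     (\<forall>u v w. br u (br v w) + br v (br w u) + br w (br u v) = 0)"

definition inner_product :: "('a::real_vector \<Rightarrow> 'a \<Rightarrow> real) \<Rightarrow> bool" where
  "inner_product g \<longleftrightarrow> bilinear g \<and> (\<forall>u v. g u v = g v u) \<and> (\<forall>u. u \<noteq> 0 \<longrightarrow> 0 < g u u)"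

text \<open>
  For left-invariant \<open>u\<close>, \<open>v\<close>, \<open>w\<close> the function \<open>g u v\<close> is constant
  on the group, so the metric condition \<open>w (g u v) = g (D w u) v + g u (D w v)\<close> has left-hand
  side \<open>0\<close>. In finite dimension exactly one \<open>D\<close> satisfies the following predicate.
\<close>

definition is_levi_civita ::
    "('a::real_vector \<Rightarrow> 'a \<Rightarrow> 'a) \<Rightarrow> ('a \<Rightarrow> 'a \<Rightarrow> real) \<Rightarrow> ('a \<Rightarrow> 'a \<Rightarrow> 'a) \<Rightarrow> bool" where
  "is_levi_civita br g D \<longleftrightarrow> bilinear D \<and>
     (\<forall>u v. D u v - D v u = br u v) \<and>
     (\<forall>u v w. g (D w u) v + g u (D w v) = 0)"

definition levi_civita ::
    "('a::real_vector \<Rightarrow> 'a \<Rightarrow> 'a) \<Rightarrow> ('a \<Rightarrow> 'a \<Rightarrow> real) \<Rightarrow> 'a \<Rightarrow> 'a \<Rightarrow> 'a" where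
  "levi_civita br g = (THE D. is_levi_civita br g D)"

definition riemann ::
    "('a::real_vector \<Rightarrow> 'a \<Rightarrow> 'a) \<Rightarrow> ('a \<Rightarrow> 'a \<Rightarrow> real) \<Rightarrow> 'a \<Rightarrow> 'a \<Rightarrow> 'a \<Rightarrow> 'a" where
  "riemann br g u v w =
     (let D = levi_civita br g in D u (D v w) - D v (D u w) - D (br u v) w)"

text \<open>
  The trace of an endomorphism, computed in an arbitrarily chosen basis. Lemma
  \<open>endo_trace_basis\<close> shows that the choice is immaterial.
\<close>

definition endo_trace :: "('a::real_vector \<Rightarrow> 'a) \<Rightarrow> real" where
  "endo_trace f = (let B = extend_basis {} in \<Sum>b\<in>B. representation B (f b) b)"

lemma sum_representation_change_basis:
  fixes f :: "'a::real_vector \<Rightarrow> 'a"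
  assumes f: "linear f"
    and B: "finite B" "independent B" "span B = UNIV"
    and C: "finite C" "independent C" "span C = UNIV"
  shows "(\<Sum>b\<in>B. representation B (f b) b) = (\<Sum>c\<in>C. representation C (f c) c)"
proof -
  have lin: "linear (\<lambda>v. representation A v a)"
    if "independent A" "span A = UNIV" for A :: "'a set" and a
    using that by (intro linearI) (simp_all add: representation_add representation_scale)
  have exp: "(\<Sum>a\<in>A. representation A v a *\<^sub>R a) = v"
    if "finite A" "independent A" "span A = UNIV" for A :: "'a set" and v
    using that by (intro sum_representation_eq) auto
  have "(\<Sum>b\<in>B. representation B (f b) b) =
      (\<Sum>b\<in>B. \<Sum>c\<in>C. representation C (f b) c * representation B c b)"
  proof (rule sum.cong[OF refl])
    fix b
    have "representation B (f b) b = representation B (\<Sum>c\<in>C. representation C (f b) c *\<^sub>R c) b"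
      using exp[OF C] by simp
    also have "\<dots> = (\<Sum>c\<in>C. representation C (f b) c * representation B c b)"
      by (simp add: linear_sum[OF lin[OF B(2,3)]] linear_scale[OF lin[OF B(2,3)]])
    finally show "representation B (f b) b = (\<Sum>c\<in>C. representation C (f b) c * representation B c b)" .
  qed
  also have "\<dots> = (\<Sum>c\<in>C. \<Sum>b\<in>B. representation C (f b) c * representation B c b)"
    by (rule sum.swap)
  also have "\<dots> = (\<Sum>c\<in>C. representation C (f c) c)"
  proof (rule sum.cong[OF refl])
    fix c
    have "representation C (f c) c = representation C (f (\<Sum>b\<in>B. representation B c b *\<^sub>R b)) c"
      using exp[OF B] by simp
    also have "\<dots> = (\<Sum>b\<in>B. representation C (f b) c * representation B c b)"
      by (simp add: linear_sum[OF f] linear_scale[OF f] linear_sum[OF lin[OF C(2,3)]]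
          linear_scale[OF lin[OF C(2,3)]] mult.commute)
    finally show "(\<Sum>b\<in>B. representation C (f b) c * representation B c b) = representation C (f c) c"
      by simp
  qed
  finally show ?thesis .
qed

lemma endo_trace_basis:
  fixes f :: "'a::real_vector \<Rightarrow> 'a"
  assumes f: "linear f" and B: "finite B" "independent B" "span B = UNIV"
  shows "endo_trace f = (\<Sum>b\<in>B. representation B (f b) b)"
proof -
  let ?E = "extend_basis {} :: 'a set"
  have E: "independent ?E" "span ?E = UNIV"
    using independent_extend_basis[OF independent_empty] span_extend_basis[OF independent_empty]
    by auto
  have "finite ?E"
    using independent_span_bound[OF B(1) E(1)] B(3) by auto
  then show ?thesis
    unfolding endo_trace_def Let_def using sum_representation_change_basis[OF f _ E B] by simp
qed

definition ricci ::
    "('a::real_vector \<Rightarrow> 'a \<Rightarrow> 'a) \<Rightarrow> ('a \<Rightarrow> 'a \<Rightarrow> real) \<Rightarrow> 'a \<Rightarrow> 'a \<Rightarrow> real" where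
  "ricci br g v w = endo_trace (\<lambda>u. riemann br g u v w)"

definition ricci_flow_on ::
    "real set \<Rightarrow> ('a::real_vector \<Rightarrow> 'a \<Rightarrow> 'a) \<Rightarrow> (real \<Rightarrow> 'a \<Rightarrow> 'a \<Rightarrow> real) \<Rightarrow> bool" where
  "ricci_flow_on I br g \<longleftrightarrow>
     (\<forall>t\<in>I. inner_product (g t) \<and>
       (\<forall>u v. ((\<lambda>s. g s u v) has_real_derivative - 2 * ricci br (g t) u v) (at t within I)))"

end

theory Submission
  imports Defs
begin

text \<open>
  The frame \<open>Y\<close> has the same brackets as \<open>X\<close>: only \<open>[Y\<^sub>1, Y\<^sub>4] = Y\<^sub>2\<close> is nonzero. For every inner
  product \<open>g\<close>, the Ricci tensor is explicit: if \<open>e\<close>, \<open>f\<close> are \<open>g\<close>-dual to the first and fourth coordinate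
  and \<open>J u = g e u f - g f u e\<close>, then the Levi-Civita connection is
  \<open>2 D\<^sub>u v = [u, v] - g(Y\<^sub>2, u) J v - g(Y\<^sub>2, v) J u\<close>. Along any flow starting at a diagonal metric the
  quotients \<open>g(Y\<^sub>2, v) / g(Y\<^sub>2, Y\<^sub>2)\<close>, then \<open>g(Y\<^sub>3, v)\<close>, then \<open>g(Y\<^sub>i, Y\<^sub>j) g(Y\<^sub>2, Y\<^sub>2)\<close> for \<open>i, j \<in> {1, 4}\<close>
  are constant, and finally \<open>g(Y\<^sub>2, Y\<^sub>2)\<^sup>-\<^sup>3\<close> grows linearly in \<open>t\<close>. These conservation laws
  determine the flow without any general theorem on ordinary differential equations.
\<close>

section \<open>Inner products and the Riesz representation\<close>

lemma inner_productD:
  assumes "inner_product g"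
  shows "g x (u + v) = g x u + g x v" "g x (u - v) = g x u - g x v" "g x (c *\<^sub>R u) = c * g x u"
    "g (u + v) x = g u x + g v x" "g (u - v) x = g u x - g v x" "g (c *\<^sub>R u) x = c * g u x"
    "g x 0 = 0" "g 0 x = 0" 
proof -
  have b: "bilinear g" using assms by (simp add: inner_product_def)
  show "g x (u + v) = g x u + g x v" "g x (u - v) = g x u - g x v" "g x (c *\<^sub>R u) = c * g x u"
    "g (u + v) x = g u x + g v x" "g (u - v) x = g u x - g v x" "g (c *\<^sub>R u) x = c * g u x"
    "g x 0 = 0" "g 0 x = 0" 
    using b by (simp_all add: bilinear_ladd bilinear_radd bilinear_lsub bilinear_rsub bilinear_lmul bilinear_rmul bilinear_lzero bilinear_rzero)
qed

lemma inner_product_commute: "inner_product g \<Longrightarrow> g u v = g v u"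
  by (simp add: inner_product_def)

lemma inner_product_pos: "inner_product g \<Longrightarrow> u \<noteq> 0 \<Longrightarrow> 0 < g u u"
  by (simp add: inner_product_def)

lemma inner_product_eqI:
  assumes "inner_product g" "\<And>w. g u w = g v w"
  shows "u = v"
  using inner_product_pos[OF assms(1), of "u - v"] assms(2)
  by (force simp: inner_productD[OF assms(1)])

text \<open>Positivity makes \<open>T\<close> injective, hence surjective in finite dimension. A
  preimage of the vector with coordinates \<open>\<phi> b\<close> then represents
  \<open>\<phi>\<close> on the basis, and so everywhere.\<close>

lemma inner_product_riesz:
  fixes g :: "'a::real_vector \<Rightarrow> 'a \<Rightarrow> real"
  assumes g: "inner_product g" and B: "finite (B :: 'a set)" "independent B" "span B = UNIV"
    and \<phi>: "linear \<phi>"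
  obtains e where "\<And>v. g e v = \<phi> v"
proof -
  \<comment> \<open>The class \<open>real_vector\<close> fixes no dimension; the finite basis
    \<open>B\<close> opens the finite-dimensional theory, in which injective endomorphisms are
    surjective.\<close>
  interpret fin: finite_dimensional_vector_space scaleR B
    using B by unfold_locales (simp_all add: dependent_raw_def span_raw_def)
  define T where "T u = (\<Sum>b\<in>B. g u b *\<^sub>R b)" for u
  have T: "linear T"
    unfolding T_def
    by (intro linearI) (simp_all add: inner_productD[OF g] scaleR_add_left sum.distrib scaleR_sum_right)
  have coeff: "(\<forall>b\<in>B. c b = d b)"
    if "(\<Sum>b\<in>B. c b *\<^sub>R b) = (\<Sum>b\<in>B. d b *\<^sub>R b)" for c d
  proof -
    have "(\<Sum>b\<in>B. (c b - d b) *\<^sub>R b) = 0"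
      using that by (simp add: scaleR_diff_left sum_subtractf)
    then show ?thesis using B(1,2) independentD[of B B "\<lambda>b. c b - d b"] by auto
  qed
  have ext: "linear f \<Longrightarrow> linear k \<Longrightarrow> \<forall>b\<in>B. f b = k b \<Longrightarrow> f v = k v"
    for f k :: "'a \<Rightarrow> real" and v
    using linear_eq_on[of f k v B] B(3) by auto
  have lin: "linear (g u)" for u
    using g by (simp add: inner_product_def bilinear_def)
  have "inj T"
  proof (rule injI)
    fix u v assume "T u = T v"
    then have "\<forall>b\<in>B. g u b = g v b" unfolding T_def by (rule coeff)
    then show "u = v" by (intro inner_product_eqI[OF g] ext[OF lin lin])
  qed
  then have "surj T"
    using fin.linear_inj_imp_surj T by (simp add: linear_def)
  then obtain e where "T e = (\<Sum>b\<in>B. \<phi> b *\<^sub>R b)" by (metis surjD)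
  then have "\<forall>b\<in>B. g e b = \<phi> b" unfolding T_def by (rule coeff)
  then show ?thesis using that ext[OF lin \<phi>] by blast
qed

section \<open>Levi-Civita connection and Ricci tensor of a bracket with one-dimensional
  image\<close>

text \<open>The Koszul formula expresses \<open>g (D u v) w\<close> through \<open>br\<close> and
  \<open>g\<close> alone, so the connection is unique and an explicit candidate only has to be
  verified.\<close>

lemma levi_civita_eqI:
  assumes g: "inner_product g" and D: "is_levi_civita br g D"
  shows "levi_civita br g = D"
proof -
  have koszul: "2 * g (D' u v) w = g (br u v) w - g (br v w) u + g (br w u) v"
    if "is_levi_civita br g D'" for D' u v w
  proof -
    have t: "br x y = D' x y - D' y x" for x y
      using that by (simp add: is_levi_civita_def)
    have m: "g x (D' z y) = - g y (D' z x)" for x y z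
      using that inner_product_commute[OF g] unfolding is_levi_civita_def
      by (metis add_eq_0_iff)
    show ?thesis
      using m[of u v w] m[of v u w] m[of v w u] m[of w u v]
      by (simp add: t inner_productD[OF g] inner_product_commute[OF g, of "D' _ _"])
  qed
  show ?thesis
    unfolding levi_civita_def
  proof (rule the_equality[where P="is_levi_civita br g", OF D])
    fix D' assume D': "is_levi_civita br g D'"
    show "D' = D"
      by (intro ext inner_product_eqI[OF g]) (use koszul[OF D] koszul[OF D'] in \<open>metis mult_cancel_left zero_neq_numeral\<close>)
  qed
qed

text \<open>The map sending \<open>u\<close> to \<open>\<phi> u\<close> times \<open>d\<close> has
  trace \<open>\<phi> d\<close>: applying \<open>\<phi>\<close> to the expansion of \<open>d\<close>
  in \<open>B\<close> yields the diagonal sum.\<close>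

lemma endo_trace_rank_three:
  fixes a b c :: "'a::real_vector"
  assumes B: "finite (B :: 'a set)" "independent B" "span B = UNIV"
    and lin: "linear \<alpha>" "linear \<beta>" "linear \<gamma>"
  shows "endo_trace (\<lambda>u. \<alpha> u *\<^sub>R a + \<beta> u *\<^sub>R b + \<gamma> u *\<^sub>R c) = \<alpha> a + \<beta> b + \<gamma> c"
proof -
  have rank1: "(\<Sum>x\<in>B. \<phi> x * representation B d x) = \<phi> d" if "linear \<phi>" for \<phi> d
  proof -
    have "\<phi> (\<Sum>x\<in>B. representation B d x *\<^sub>R x) = (\<Sum>x\<in>B. \<phi> x * representation B d x)"
      by (simp add: linear_sum[OF that] linear_scale[OF that] mult.commute)
    then show ?thesis using B by (simp add: sum_representation_eq)
  qed
  have "linear (\<lambda>u. \<alpha> u *\<^sub>R a + \<beta> u *\<^sub>R b + \<gamma> u *\<^sub>R c)"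
    using lin by (auto simp: linear_iff algebra_simps)
  from endo_trace_basis[OF this B] show ?thesis
    by (simp add: representation_add representation_scale B
        sum.distrib rank1 lin)
qed

text \<open>The bracket is a 2-form times \<open>z\<close>, and \<open>z\<close> is central because
  both factors of the form vanish on it. Connection and curvature take values in the span of
  \<open>z\<close>, \<open>e\<close>, \<open>f\<close>, so the Ricci trace reduces to three
  evaluations.\<close>

lemma ricci_rank_one_bracket:
  fixes br :: "'a::real_vector \<Rightarrow> 'a \<Rightarrow> 'a"
  assumes g: "inner_product g" and B: "finite (B :: 'a set)" "independent B" "span B = UNIV"
    and br: "\<And>u v. br u v = (g e u * g f v - g f u * g e v) *\<^sub>R z"
    and z: "g e z = 0" "g f z = 0"
  shows "ricci br g v w =
    (g e e * g f f - (g e f)\<^sup>2) / 2 * g z v * g z w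
    - g z z / 2 * (g e v * g e w * g f f - (g e v * g f w + g f v * g e w) * g e f + g f v * g f w * g e e)"
proof -
  \<comment> \<open>The Koszul formula, read as a linear form in its last argument, gives these
    coefficients of \<open>z\<close>, \<open>e\<close> and \<open>f\<close>.\<close>
  define a where "a u v = (g e u * g f v - g f u * g e v) / 2" for u v
  define b where "b u v = (g z u * g f v + g z v * g f u) / 2" for u v
  define c where "c u v = - (g z u * g e v + g z v * g e u) / 2" for u v
  define D where "D u v = a u v *\<^sub>R z + b u v *\<^sub>R e + c u v *\<^sub>R f" for u v
  note ip = inner_productD[OF g]
  have sym: "g z e = 0" "g z f = 0" "g f e = g e f"
    using z inner_product_commute[OF g] by metis+
  have "is_levi_civita br g D"
    unfolding is_levi_civita_def
  proof (intro conjI allI)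
    show "bilinear D"
      unfolding bilinear_def linear_iff D_def a_def b_def c_def
      by (auto simp: ip algebra_simps add_divide_distrib diff_divide_distrib)
    show "D u v - D v u = br u v" for u v
    proof -
      have "D u v - D v u = (a u v - a v u) *\<^sub>R z + (b u v - b v u) *\<^sub>R e + (c u v - c v u) *\<^sub>R f"
        by (simp add: D_def algebra_simps)
      moreover have "a u v - a v u = g e u * g f v - g f u * g e v" "b u v = b v u" "c u v = c v u"
        by (simp_all add: a_def b_def c_def field_simps)
      ultimately show ?thesis by (simp add: br)
    qed
    show "g (D w u) v + g u (D w v) = 0" for u v w
      by (simp add: D_def ip a_def b_def c_def inner_product_commute[OF g, of u] field_simps)
  qed
  then have lc: "levi_civita br g = D" by (rule levi_civita_eqI[OF g])
  let ?co = "\<lambda>k u. k u (D v w) - k v (D u w) - k (br u v) w"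
  have gD: "g x (D u v) = a u v * g x z + b u v * g x e + c u v * g x f" for x u v
    by (simp add: D_def ip)
  have gbr: "g x (br u v) = (g e u * g f v - g f u * g e v) * g x z" for x u v
    by (simp add: br ip)
  have "(\<lambda>u. riemann br g u v w) = (\<lambda>u. ?co a u *\<^sub>R z + ?co b u *\<^sub>R e + ?co c u *\<^sub>R f)"
    unfolding riemann_def lc Let_def
    \<comment> \<open>Only the outer \<open>D\<close> of each curvature term is unfolded; the inner
      ones stay as arguments of the coefficient forms.\<close>
    by (rule ext) (subst (1 3 5) D_def, simp add: algebra_simps)
  then have "ricci br g v w = ?co a z + ?co b e + ?co c f"
    unfolding ricci_def
    by (simp only:, intro endo_trace_rank_three[OF B])
      (simp_all add: linear_iff a_def b_def c_def gD gbr z sym ip, auto simp: field_simps)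
  then show ?thesis
    by (simp add: a_def b_def c_def gD gbr z sym ip) (simp add: field_simps power2_eq_square)
qed


section \<open>The frame of Heisenberg type and its Ricci tensor\<close>

text \<open>The basis \<open>B\<close> only serves to express that the Lie algebra has finite dimension.\<close>

locale heisenberg_frame =
  fixes br :: "'a::real_vector \<Rightarrow> 'a \<Rightarrow> 'a" and B :: "'a set" and y1 y2 y3 y4 :: 'a
    and e1 e2 e3 e4 :: "'a \<Rightarrow> real"
  assumes bilinear_br: "bilinear br"
    and B: "finite B" "independent B" "span B = UNIV"
    and br_frame: "br y1 y1 = 0" "br y1 y2 = 0" "br y1 y3 = 0" "br y1 y4 = y2"
      "br y2 y1 = 0" "br y2 y2 = 0" "br y2 y3 = 0" "br y2 y4 = 0"
      "br y3 y1 = 0" "br y3 y2 = 0" "br y3 y3 = 0" "br y3 y4 = 0"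
      "br y4 y1 = - y2" "br y4 y2 = 0" "br y4 y3 = 0" "br y4 y4 = 0"
    and lin: "linear e1" "linear e2" "linear e3" "linear e4"
    and dual: "e1 y1 = 1" "e1 y2 = 0" "e1 y3 = 0" "e1 y4 = 0"
      "e2 y1 = 0" "e2 y2 = 1" "e2 y3 = 0" "e2 y4 = 0"
      "e3 y1 = 0" "e3 y2 = 0" "e3 y3 = 1" "e3 y4 = 0"
      "e4 y1 = 0" "e4 y2 = 0" "e4 y3 = 0" "e4 y4 = 1"
    and span_frame: "span {y1, y2, y3, y4} = UNIV"
begin

lemmas lin_simps = lin[THEN linear_add] lin[THEN linear_diff] lin[THEN linear_scale] lin[THEN linear_0]

lemma bilinear_frame_eqI:
  assumes "bilinear f" "bilinear k"
    and "\<And>x y. x \<in> {y1, y2, y3, y4} \<Longrightarrow> y \<in> {y1, y2, y3, y4} \<Longrightarrow> f x y = k x y"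
  shows "f u v = k u v"
  by (rule bilinear_eq[OF assms(1,2) _ _ _ _ assms(3), of UNIV "{y1, y2, y3, y4}" UNIV "{y1, y2, y3, y4}"])
    (simp_all add: span_frame)

lemma frame_expansion: "v = e1 v *\<^sub>R y1 + e2 v *\<^sub>R y2 + e3 v *\<^sub>R y3 + e4 v *\<^sub>R y4"
proof -
  have "linear (\<lambda>v. e1 v *\<^sub>R y1 + e2 v *\<^sub>R y2 + e3 v *\<^sub>R y3 + e4 v *\<^sub>R y4)"
    by (auto simp: linear_iff lin_simps algebra_simps)
  from linear_eq_on[OF linear_ident this, of v "{y1, y2, y3, y4}"] show ?thesis
    using span_frame dual by force
qed

lemma br_eq: "br u v = (e1 u * e4 v - e4 u * e1 v) *\<^sub>R y2"
  by (rule bilinear_frame_eqI[OF bilinear_br])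
    (auto simp: bilinear_def linear_iff lin_simps algebra_simps br_frame dual)

text \<open>The vectors \<open>a\<close>, \<open>b\<close> are the \<open>g\<close>-duals of the
  forms \<open>e1\<close>, \<open>e4\<close>, so \<open>e1 a\<close>, \<open>e4 a\<close>,
  \<open>e4 b\<close> are the entries of their Gram matrix, and the factor in the last line is its
  determinant.\<close>

lemma ricci_eq:
  assumes g: "inner_product g" and a: "\<And>v. g a v = e1 v" and b: "\<And>v. g b v = e4 v"
  shows "- 2 * ricci br g v w =
    g y2 y2 * (e1 v * e1 w * e4 b - (e1 v * e4 w + e4 v * e1 w) * e4 a + e4 v * e4 w * e1 a)
    - (e1 a * e4 b - (e4 a)\<^sup>2) * g y2 v * g y2 w"
proof -
  have "e1 b = e4 a" using a b inner_product_commute[OF g] by metis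
  moreover have "br u v = (g a u * g b v - g b u * g a v) *\<^sub>R y2" for u v
    by (simp add: a b br_eq)
  ultimately show ?thesis
    using ricci_rank_one_bracket[OF g B, of br a b y2 v w] by (simp add: a b dual)
qed

text \<open>Both \<open>e1\<close> and \<open>e4\<close> vanish on \<open>y2\<close> and
  \<open>y3\<close>, so only the determinant term survives. The same \<open>K\<close> serves every
  \<open>v\<close>, which is what makes the quotients by \<open>g y2 y2\<close> constant along a
  flow.\<close>

lemma ricci_y2:
  assumes g: "inner_product g"
  shows "\<exists>K. (\<forall>v. - 2 * ricci br g y2 v = - K * g y2 y2 * g y2 v) \<and>
    (\<forall>v. - 2 * ricci br g y3 v = - K * g y2 y3 * g y2 v)"
proof -
  obtain a b where "\<And>v. g a v = e1 v" "\<And>v. g b v = e4 v"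
    using inner_product_riesz[OF g B] lin by metis
  note ricci = ricci_eq[OF g this]
  show ?thesis
    unfolding ricci by (rule exI[of _ "e1 a * e4 b - (e4 a)\<^sup>2"]) (simp add: dual algebra_simps)
qed

text \<open>The \<open>y1\<close>, \<open>y4\<close> block is orthogonal to \<open>y2\<close> and
  \<open>y3\<close>, so the dual vectors come from inverting a 2 by 2 matrix; the adjugate in
  \<open>ricci_eq\<close> then returns the block itself. The entry \<open>g y1 y4\<close> is kept
  general, since its vanishing along a flow is deduced from these formulas.\<close>

lemma ricci_block:
  assumes g: "inner_product g"
    and zero: "g y2 y1 = 0" "g y2 y3 = 0" "g y2 y4 = 0" "g y3 y1 = 0" "g y3 y4 = 0"
  defines "d \<equiv> g y1 y1 * g y4 y4 - (g y1 y4)\<^sup>2"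
  shows "0 < d"
    and "- 2 * ricci br g y2 y2 = - (g y2 y2)\<^sup>2 / d"
    and "v \<in> {y1, y4} \<Longrightarrow> w \<in> {y1, y4} \<Longrightarrow> - 2 * ricci br g v w = g y2 y2 * g v w / d"
proof -
  note ip = inner_productD[OF g]
  note sym = inner_product_commute[OF g]
  \<comment> \<open>This is \<open>g y4 y4\<close> times the component of \<open>y1\<close>
    orthogonal to \<open>y4\<close>; its squared length is \<open>g y4 y4 * d\<close>.\<close>
  let ?x = "g y4 y4 *\<^sub>R y1 - g y1 y4 *\<^sub>R y4"
  have "e4 y4 \<noteq> e4 0" by (simp add: dual lin_simps)
  then have 4: "0 < g y4 y4" by (intro inner_product_pos[OF g]) auto
  have "e1 ?x \<noteq> e1 0" using 4 by (simp add: dual lin_simps)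
  then have "0 < g ?x ?x" by (intro inner_product_pos[OF g]) metis
  also have "g ?x ?x = g y4 y4 * d"
    by (simp add: ip d_def sym[of y4 y1] power2_eq_square algebra_simps)
  finally show d: "0 < d" using 4 by (simp add: zero_less_mult_iff)
  have exp: "g x v = e1 v * g x y1 + e2 v * g x y2 + e3 v * g x y3 + e4 v * g x y4" for x v
    by (subst frame_expansion[of v]) (simp only: ip)
  \<comment> \<open>The coefficients of \<open>a\<close> and \<open>b\<close> are the columns of the
    inverse of the \<open>y1\<close>, \<open>y4\<close> block.\<close>
  define a where "a = (1 / d) *\<^sub>R ?x"
  define b where "b = (1 / d) *\<^sub>R (g y1 y1 *\<^sub>R y4 - g y1 y4 *\<^sub>R y1)"
  have zero': "g y1 y2 = 0" "g y3 y2 = 0" "g y4 y2 = 0" "g y1 y3 = 0" "g y4 y3 = 0"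
    using zero sym by metis+
  have "g a y1 = 1" "g a y4 = 0" "g b y1 = 0" "g b y4 = 1"
    using d by (simp_all add: a_def b_def ip sym[of y4 y1] divide_simps)
      (simp_all add: d_def power2_eq_square algebra_simps)
  moreover have "g a y2 = 0" "g a y3 = 0" "g b y2 = 0" "g b y3 = 0"
    by (simp_all add: a_def b_def ip zero')
  ultimately have ab: "g a v = e1 v" "g b v = e4 v" for v
    by (simp_all add: exp[of a v] exp[of b v])
  have e: "e1 a = g y4 y4 / d" "e4 a = - g y1 y4 / d" "e4 b = g y1 y1 / d"
    by (simp_all add: a_def b_def lin_simps dual)
  have det: "e1 a * e4 b - (e4 a)\<^sup>2 = 1 / d"
    using d unfolding e by (simp add: field_simps power2_eq_square) (simp add: d_def power2_eq_square algebra_simps)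
  show "- 2 * ricci br g y2 y2 = - (g y2 y2)\<^sup>2 / d"
    unfolding ricci_eq[OF g ab] det by (simp add: dual power2_eq_square)
  show "- 2 * ricci br g v w = g y2 y2 * g v w / d" if "v \<in> {y1, y4}" "w \<in> {y1, y4}"
    using that unfolding ricci_eq[OF g ab] det by (auto simp: dual zero e sym[of y4 y1])
qed

section \<open>Conservation laws along an arbitrary solution\<close>

lemma flow_const:
  fixes f :: "real \<Rightarrow> real"
  assumes "is_interval I" "0 \<in> I" "\<And>t. t \<in> I \<Longrightarrow> (f has_real_derivative 0) (at t within I)" "t \<in> I"
  shows "f t = f 0"
  using has_field_derivative_zero_constant[of I f] assms is_interval_convex by metis

lemma flow_invariants:
  assumes I: "is_interval I" "0 \<in> I" and flow: "ricci_flow_on I br h"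
    and zero: "h 0 y2 y1 = 0" "h 0 y2 y3 = 0" "h 0 y2 y4 = 0" "h 0 y3 y1 = 0" "h 0 y3 y4 = 0"
    and l: "h 0 y2 y2 = l2" "h 0 y1 y1 = l1" "h 0 y4 y4 = l4" "h 0 y1 y4 = 0"
    and t: "t \<in> I"
  shows "h t y2 y1 = 0" "h t y2 y3 = 0" "h t y2 y4 = 0" "h t y3 y1 = 0" "h t y3 y4 = 0"
    and "h t y1 y4 = 0" "h t y3 y3 = h 0 y3 y3"
    and "0 < h t y2 y2" "h t y1 y1 * h t y2 y2 = l1 * l2" "h t y4 y4 * h t y2 y2 = l4 * l2"
    and "(l2 / h t y2 y2) ^ 3 = 1 + 3 * (l2 / (l1 * l4)) * t"
proof -
  have ip: "inner_product (h t)" if "t \<in> I" for t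
    using flow that by (simp add: ricci_flow_on_def)
  have der: "((\<lambda>s. h s u v) has_real_derivative - 2 * ricci br (h t) u v) (at t within I)"
    if "t \<in> I" for t u v
    using flow that by (simp add: ricci_flow_on_def)
  note const = flow_const[OF I]
  have nz: "y1 \<noteq> 0" "y2 \<noteq> 0" "y4 \<noteq> 0"
    using dual lin_simps by (metis zero_neq_one)+
  have pos: "0 < h t y2 y2" "0 < h t y1 y1" "0 < h t y4 y4" if "t \<in> I" for t
    using inner_product_pos[OF ip[OF that]] nz by auto
  have z2: "h t y2 v = 0" if "h 0 y2 v = 0" "t \<in> I" for v t
  proof -
    \<comment> \<open>Numerator and denominator have the same logarithmic rate
      \<open>- K * h s y2 y2\<close>, so their quotient is constant.\<close>
    have "((\<lambda>s. h s y2 v / h s y2 y2) has_real_derivative 0) (at s within I)" if s: "s \<in> I" for s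
    proof -
      obtain K where K: "- 2 * ricci br (h s) y2 v = - K * h s y2 y2 * h s y2 v" for v
        using ricci_y2[OF ip[OF s]] by blast
      show ?thesis
        using pos(1)[OF s] DERIV_divide[OF der[OF s, of y2 v] der[OF s, of y2 y2]]
        unfolding K by (simp add: algebra_simps)
    qed
    from const[OF this \<open>t \<in> I\<close>] show ?thesis
      using that pos(1)[OF that(2)] by simp
  qed
  have z3: "h t y3 v = h 0 y3 v" if "t \<in> I" for v t
  proof (rule const[OF _ that])
    fix s assume s: "s \<in> I"
    obtain K where "- 2 * ricci br (h s) y3 v = - K * h s y2 y3 * h s y2 v"
      using ricci_y2[OF ip[OF s]] by blast
    \<comment> \<open>The right-hand side carries the factor \<open>h s y2 y3\<close>, which is
      already known to vanish.\<close>
    with z2[OF zero(2) s] have "- 2 * ricci br (h s) y3 v = 0" by simp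
    then show "((\<lambda>s. h s y3 v) has_real_derivative 0) (at s within I)"
      using der[OF s, of y3 v] by simp
  qed
  define d where "d s = h s y1 y1 * h s y4 y4 - (h s y1 y4)\<^sup>2" for s
  have zs: "h s y2 y1 = 0" "h s y2 y3 = 0" "h s y2 y4 = 0" "h s y3 y1 = 0" "h s y3 y4 = 0"
    if "s \<in> I" for s
    using that z2 z3 zero by auto
  have d: "0 < d s"
    and d2: "((\<lambda>s. h s y2 y2) has_real_derivative - (h s y2 y2)\<^sup>2 / d s) (at s within I)"
    and dvw: "v \<in> {y1, y4} \<Longrightarrow> w \<in> {y1, y4} \<Longrightarrow>
      ((\<lambda>s. h s v w) has_real_derivative h s y2 y2 * h s v w / d s) (at s within I)"
    if s: "s \<in> I" for s v w
  proof -
    note block = ricci_block[OF ip[OF s] zs[OF s], folded d_def]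
    show "0 < d s" by (rule block(1))
    show "((\<lambda>s. h s y2 y2) has_real_derivative - (h s y2 y2)\<^sup>2 / d s) (at s within I)"
      using der[OF s, of y2 y2] unfolding block(2) .
    show "((\<lambda>s. h s v w) has_real_derivative h s y2 y2 * h s v w / d s) (at s within I)"
      if "v \<in> {y1, y4}" "w \<in> {y1, y4}"
      using der[OF s, of v w] unfolding block(3)[OF that] .
  qed
  have prod: "h t v w * h t y2 y2 = h 0 v w * h 0 y2 y2"
    if "v \<in> {y1, y4}" "w \<in> {y1, y4}" "t \<in> I" for v w t
  proof (rule const[OF _ that(3)])
    fix s assume s: "s \<in> I"
    \<comment> \<open>The rates of the two factors are \<open>h s y2 y2 / d s\<close> and its
      negative.\<close>
    show "((\<lambda>s. h s v w * h s y2 y2) has_real_derivative 0) (at s within I)"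
      using DERIV_mult[OF dvw[OF s that(1,2)] d2[OF s]] by (simp add: power2_eq_square)
  qed
  have p11: "h t y1 y1 * h t y2 y2 = l1 * l2" and p44: "h t y4 y4 * h t y2 y2 = l4 * l2"
    and p14: "h t y1 y4 = 0" if "t \<in> I" for t
    using prod[OF _ _ that, of y1 y1] prod[OF _ _ that, of y4 y4] prod[OF _ _ that, of y1 y4] l
      pos(1)[OF that] by auto
  have lpos: "0 < l1" "0 < l2" "0 < l4" using pos[OF I(2)] l by auto
  \<comment> \<open>With \<open>A = h s y2 y2\<close> the constant products give
    \<open>d s = l1 * l4 * l2^2 / A^2\<close>. Hence \<open>A' = - A^4 / (l1 * l4 * l2^2)\<close>,
    and the cube of \<open>l2 / A\<close> has constant derivative \<open>3 * ?k\<close>.\<close>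
  let ?k = "l2 / (l1 * l4)"
  have "((\<lambda>s. (l2 / h s y2 y2) ^ 3 - 3 * ?k * s) has_real_derivative 0) (at s within I)"
    if s: "s \<in> I" for s
  proof -
    let ?A = "h s y2 y2"
    have A: "0 < ?A" using pos[OF s] by simp
    have "d s * ?A\<^sup>2 = (h s y1 y1 * ?A) * (h s y4 y4 * ?A)"
      using p14[OF s] by (simp add: d_def power2_eq_square)
    also have "\<dots> = l1 * l4 * l2\<^sup>2" unfolding p11[OF s] p44[OF s] by (simp add: power2_eq_square)
    finally have ds: "d s = l1 * l4 * l2\<^sup>2 / ?A\<^sup>2" using A by (simp add: field_simps)
    define A' where "A' = - ?A\<^sup>2 / d s"
    have A': "((\<lambda>s. h s y2 y2) has_real_derivative A') (at s within I)"
      using d2[OF s] by (simp add: A'_def)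
    have "((\<lambda>s. (l2 / h s y2 y2) ^ 3 - 3 * ?k * s) has_real_derivative
      3 * (l2 / ?A)\<^sup>2 * (- l2 * A' / ?A\<^sup>2) - 3 * ?k) (at s within I)"
      by (rule derivative_eq_intros A' refl | use A in \<open>simp add: power2_eq_square\<close>)+
    moreover have "3 * (l2 / ?A)\<^sup>2 * (- l2 * A' / ?A\<^sup>2) - 3 * ?k = 0"
      using A lpos by (simp add: A'_def ds field_simps power2_eq_square)
    ultimately show ?thesis by simp
  qed
  from const[OF this t] show "(l2 / h t y2 y2) ^ 3 = 1 + 3 * ?k * t"
    using l lpos by simp
  show "h t y2 y1 = 0" "h t y2 y3 = 0" "h t y2 y4 = 0" "h t y3 y1 = 0" "h t y3 y4 = 0"
    "h t y1 y4 = 0" "h t y3 y3 = h 0 y3 y3"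
    "0 < h t y2 y2" "h t y1 y1 * h t y2 y2 = l1 * l2" "h t y4 y4 * h t y2 y2 = l4 * l2"
    using zs[OF t] p14[OF t] z3[OF t] pos[OF t] p11[OF t] p44[OF t] by auto
qed

end

section \<open>The explicit solution and its uniqueness\<close>

locale heisenberg_diagonal = heisenberg_frame +
  fixes l1 l2 l3 l4 :: real
  assumes l_pos: "0 < l1" "0 < l2" "0 < l3" "0 < l4"
begin

text \<open>The value that the cubic law of \<open>flow_invariants\<close> forces on
  \<open>l2 / h t y2 y2\<close>.\<close>

definition scale :: "real \<Rightarrow> real" where
  "scale t = root 3 (1 + 3 * (l2 / (l1 * l4)) * t)"

text \<open>The powers of \<open>scale\<close> keep the \<open>y3\<close> coefficient and the
  products of the \<open>y1\<close> and \<open>y4\<close> coefficients with that of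
  \<open>y2\<close> constant, as the conservation laws demand.\<close>

definition metric :: "real \<Rightarrow> 'a \<Rightarrow> 'a \<Rightarrow> real" where
  "metric t u v = l1 * scale t * (e1 u * e1 v) + l2 / scale t * (e2 u * e2 v)
     + l3 * (e3 u * e3 v) + l4 * scale t * (e4 u * e4 v)"

lemma radicand_pos: "0 \<le> t \<Longrightarrow> 0 < 1 + 3 * (l2 / (l1 * l4)) * t"
  using l_pos by (intro add_pos_nonneg) auto

lemma scale_pos: "0 \<le> t \<Longrightarrow> 0 < scale t"
  using radicand_pos by (simp add: scale_def)

lemma scale_deriv:
  assumes "0 \<le> t"
  shows "(scale has_real_derivative l2 / (l1 * l4 * (scale t)\<^sup>2)) (at t within S)"
proof -
  define k where "k = l2 / (l1 * l4)"
  have scale: "scale = (\<lambda>t. root 3 (1 + 3 * k * t))"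
    by (simp add: scale_def k_def fun_eq_iff)
  have "0 < 1 + 3 * k * t"
    using radicand_pos[OF assms] by (simp add: k_def)
  then have root: "(root 3 has_real_derivative inverse (3 * (scale t)\<^sup>2)) (at (1 + 3 * k * t))"
    using DERIV_real_root[of 3 "1 + 3 * k * t"] by (simp add: scale)
  have "((\<lambda>t. 1 + 3 * k * t) has_real_derivative 3 * k) (at t within S)"
    by (rule derivative_eq_intros refl)+ simp
  from DERIV_chain2[where g = "\<lambda>t. 1 + 3 * k * t", OF root this]
  have "(scale has_real_derivative inverse (3 * (scale t)\<^sup>2) * (3 * k)) (at t within S)"
    by (simp only: scale)
  moreover have "inverse (3 * (scale t)\<^sup>2) * (3 * k) = l2 / (l1 * l4 * (scale t)\<^sup>2)"
    using l_pos scale_pos[OF assms] by (simp add: k_def field_simps)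
  ultimately show ?thesis by simp
qed

lemma metric_frame:
  "metric t y1 v = l1 * scale t * e1 v" "metric t y2 v = l2 / scale t * e2 v"
  "metric t y3 v = l3 * e3 v" "metric t y4 v = l4 * scale t * e4 v"
  by (simp_all add: metric_def dual)

lemma inner_product_metric:
  assumes "0 \<le> t"
  shows "inner_product (metric t)"
  unfolding inner_product_def
proof (intro conjI allI impI)
  show "bilinear (metric t)"
    by (auto simp: metric_def bilinear_def linear_iff lin_simps algebra_simps add_divide_distrib)
  show "metric t u v = metric t v u" for u v
    by (simp add: metric_def mult.commute)
  show "0 < metric t u u" if "u \<noteq> 0" for u
  proof -
    have "u = 0" if "e1 u = 0" "e2 u = 0" "e3 u = 0" "e4 u = 0"
      by (subst frame_expansion[of u]) (simp add: that)
    with that have nz: "e1 u \<noteq> 0 \<or> e2 u \<noteq> 0 \<or> e3 u \<noteq> 0 \<or> e4 u \<noteq> 0" by blast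
    have pos: "0 \<le> c * (x * x)" "x \<noteq> 0 \<Longrightarrow> 0 < c * (x * x)" if "0 < c" for c x :: real
      using that by (auto simp: zero_less_mult_iff)
    have c: "0 < l1 * scale t" "0 < l2 / scale t" "0 < l4 * scale t"
      using l_pos scale_pos[OF assms] by auto
    show ?thesis
      unfolding metric_def
      using nz pos[OF c(1), of "e1 u"] pos[OF c(2), of "e2 u"] pos[OF l_pos(3), of "e3 u"]
        pos[OF c(3), of "e4 u"]
      by (elim disjE) linarith+
  qed
qed

text \<open>Comparing the coefficients of the \<open>e1\<close>, \<open>e2\<close> and
  \<open>e4\<close> squares gives three times the same equation, the one satisfied by
  \<open>scale\<close> in \<open>scale_deriv\<close>; the \<open>e3\<close> term is constant in
  time.\<close>

lemma ricci_flow_metric: "ricci_flow_on {0..} br metric"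
  unfolding ricci_flow_on_def
proof (intro ballI conjI allI)
  fix t :: real and u v :: 'a
  assume "t \<in> {0..}"
  then have t: "0 \<le> t" by simp
  note r = scale_pos[OF t]
  show ip: "inner_product (metric t)" by (rule inner_product_metric[OF t])
  \<comment> \<open>The frame is orthogonal for \<open>metric t\<close>, so the vectors dual to
    \<open>e1\<close> and \<open>e4\<close> are rescaled frame vectors.\<close>
  let ?a = "(1 / (l1 * scale t)) *\<^sub>R y1" and ?b = "(1 / (l4 * scale t)) *\<^sub>R y4"
  have "metric t ?a v = e1 v" "metric t ?b v = e4 v" for v
    using l_pos r by (simp_all add: inner_productD[OF ip] metric_frame)
  from ricci_eq[OF ip this, of u v]
  have ric: "- 2 * ricci br (metric t) u v =
      l2 / scale t * (e1 u * e1 v / (l4 * scale t) + e4 u * e4 v / (l1 * scale t))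
      - (l2 / scale t)\<^sup>2 / (l1 * scale t * (l4 * scale t)) * (e2 u * e2 v)"
    by (simp add: metric_frame dual lin_simps) (simp add: power2_eq_square algebra_simps)
  define s' where "s' = l2 / (l1 * l4 * (scale t)\<^sup>2)"
  have s': "(scale has_real_derivative s') (at t within {0..})"
    using scale_deriv[OF t] by (simp add: s'_def)
  have "((\<lambda>s. metric s u v) has_real_derivative
      l1 * s' * (e1 u * e1 v) + - l2 * s' / (scale t)\<^sup>2 * (e2 u * e2 v) + l4 * s' * (e4 u * e4 v))
      (at t within {0..})"
    unfolding metric_def using r
    by (auto intro!: derivative_eq_intros s' simp: power2_eq_square)
  moreover have "l1 * s' * (e1 u * e1 v) + - l2 * s' / (scale t)\<^sup>2 * (e2 u * e2 v)
      + l4 * s' * (e4 u * e4 v) = - 2 * ricci br (metric t) u v"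
    unfolding ric s'_def using r l_pos by (simp add: field_simps power2_eq_square)
  ultimately show "((\<lambda>s. metric s u v) has_real_derivative - 2 * ricci br (metric t) u v) (at t within {0..})"
    by simp
qed

text \<open>The invariants fix every entry in the frame: the cubic law yields
  \<open>h t y2 y2\<close>, and the constant products then yield the \<open>y1\<close> and
  \<open>y4\<close> entries. Since \<open>I\<close> may be any interval from \<open>0\<close>,
  solutions of short duration are covered as well.\<close>

lemma ricci_flow_unique:
  assumes I: "is_interval I" "0 \<in> I" "I \<subseteq> {0..}" and flow: "ricci_flow_on I br h"
    and h0: "h 0 = metric 0" and t: "t \<in> I"
  shows "h t = metric t"
proof -
  have s0: "scale 0 = 1" by (simp add: scale_def)
  have "0 \<le> t" using I t by auto
  note r = scale_pos[OF this]
  note inv = flow_invariants[OF I(1,2) flow, of l2 l1 l4 t, unfolded h0,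
      simplified metric_frame dual s0, simplified, OF t]
  have ip: "inner_product (h t)" using flow t by (simp add: ricci_flow_on_def)
  \<comment> \<open>The real cube root undoes the cube, as \<open>l2 / h t y2 y2\<close> is
    positive.\<close>
  have "scale t = root 3 ((l2 / h t y2 y2) ^ 3)"
    unfolding inv(11) by (simp add: scale_def)
  also have "\<dots> = l2 / h t y2 y2"
    using inv(8) l_pos by (intro real_root_power_cancel) auto
  finally have 2: "h t y2 y2 = l2 / scale t" using inv(8) l_pos r by (simp add: field_simps)
  have 1: "h t y1 y1 = l1 * scale t" and 4: "h t y4 y4 = l4 * scale t"
    using inv(9,10) l_pos r unfolding 2 by (simp_all add: field_simps)
  have "h t u v = metric t u v" for u v
  proof (rule bilinear_frame_eqI)
    show "bilinear (h t)" "bilinear (metric t)"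
      using ip inner_product_metric[OF \<open>0 \<le> t\<close>] by (simp_all add: inner_product_def)
    note sym = inner_product_commute[OF ip]
    have "h t y1 y2 = 0" "h t y3 y2 = 0" "h t y4 y2 = 0" "h t y1 y3 = 0" "h t y4 y3 = 0" "h t y4 y1 = 0"
      using inv(1-6) sym by metis+
    then show "h t x y = metric t x y" if "x \<in> {y1, y2, y3, y4}" "y \<in> {y1, y2, y3, y4}" for x y
      using that by (elim insertE emptyE) (simp_all add: inv(1-7) 1 2 4 metric_frame dual)
  qed
  then show ?thesis by blast
qed

end

section \<open>Transfer to the given Lie algebra and metric\<close>

text \<open>Speaking of the solution requires existence on the whole half-line and agreement of
  every solution on a subinterval containing \<open>0\<close>; both are asserted along with
  diagonality.\<close>

theorem proposition3:
  fixes br :: "'a::real_vector \<Rightarrow> 'a \<Rightarrow> 'a"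
    and X1 X2 X3 X4 :: 'a
    and a1 a2 a3 a4 a5 a6 :: real
    and Y :: "nat \<Rightarrow> 'a"
    and lam :: "nat \<Rightarrow> real"
    and g0 :: "'a \<Rightarrow> 'a \<Rightarrow> real"
  assumes lie: "lie_algebra br"
    and basis: "distinct [X1, X2, X3, X4]" "independent {X1, X2, X3, X4}"
      "span {X1, X2, X3, X4} = UNIV"
    and brackets: "br X2 X3 = 0" "br X3 X1 = 0" "br X1 X2 = 0"
      "br X1 X4 = X2" "br X2 X4 = 0" "br X3 X4 = 0"
    and Y: "Y 1 = X1 + a2 *\<^sub>R X2 + a3 *\<^sub>R X3"
      "Y 2 = X2"
      "Y 3 = a1 *\<^sub>R X2 + X3"
      "Y 4 = a4 *\<^sub>R X1 + a5 *\<^sub>R X2 + a6 *\<^sub>R X3 + X4"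
    and g0: "inner_product g0"
    and lam_pos: "\<forall>i\<in>{1..4}. 0 < lam i"
    and g0_diag: "\<forall>i\<in>{1..4}. \<forall>j\<in>{1..4}. g0 (Y i) (Y j) = (if i = j then lam i else 0)"
  shows "\<exists>g. ricci_flow_on {0..} br g \<and> g 0 = g0 \<and>
      (\<forall>I h. is_interval I \<and> 0 \<in> I \<and> I \<subseteq> {0..} \<and> ricci_flow_on I br h \<and> h 0 = g0
         \<longrightarrow> (\<forall>t\<in>I. h t = g t)) \<and>
      (\<forall>t\<ge>0. \<forall>i\<in>{1..4}. \<forall>j\<in>{1..4}. i \<noteq> j \<longrightarrow> g t (Y i) (Y j) = 0)"
proof -
  \<comment> \<open>Keeps the index in \<open>Y 1\<close> from being rewritten to
    \<open>Suc 0\<close>.\<close>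
  note One_nat_def [simp del]
  have bil: "bilinear br" and alt: "br u u = 0" for u
    using lie by (auto simp: lie_algebra_def)
  note br_simps = bilinear_ladd[OF bil] bilinear_radd[OF bil] bilinear_lmul[OF bil] bilinear_rmul[OF bil]
  have skew: "br u v = - br v u" for u v
  proof -
    have "br (u + v) (u + v) = br u u + br v v + (br u v + br v u)"
      unfolding br_simps by (simp add: algebra_simps)
    then show ?thesis by (simp add: alt eq_neg_iff_add_eq_0)
  qed
  have brX: "br X3 X2 = 0" "br X1 X3 = 0" "br X2 X1 = 0" "br X4 X1 = - X2" "br X4 X2 = 0" "br X4 X3 = 0"
    using skew[of X3 X2] skew[of X1 X3] skew[of X2 X1] skew[of X4 X1] skew[of X4 X2] skew[of X4 X3]
    by (simp_all add: brackets)
  have I4: "{1..4} = {1::nat, 2, 3, 4}" by auto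
  have lam: "0 < lam 1" "0 < lam 2" "0 < lam 3" "0 < lam 4"
    using lam_pos by (auto simp: I4)
  have diag: "g0 (Y i) (Y j) = (if i = j then lam i else 0)"
    if "i \<in> {1, 2, 3, 4}" "j \<in> {1, 2, 3, 4}" for i j
    using g0_diag that unfolding I4 by blast
  let ?S = "span {Y 1, Y 2, Y 3, Y 4}"
  have Ys: "Y 1 \<in> ?S" "Y 2 \<in> ?S" "Y 3 \<in> ?S" "Y 4 \<in> ?S"
    by (simp_all add: span_base)
  \<comment> \<open>The change of basis is solved successively for \<open>X2\<close>,
    \<open>X3\<close>, \<open>X1\<close>, \<open>X4\<close>.\<close>
  have X2: "X2 \<in> ?S" using Ys Y by simp
  have "X3 = Y 3 - a1 *\<^sub>R X2" by (simp add: Y)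
  then have X3: "X3 \<in> ?S" using Ys X2 by (metis span_diff span_scale)
  have "X1 = Y 1 - a2 *\<^sub>R X2 - a3 *\<^sub>R X3" by (simp add: Y)
  then have X1: "X1 \<in> ?S" using Ys X2 X3 by (metis span_diff span_scale)
  have "X4 = Y 4 - a4 *\<^sub>R X1 - a5 *\<^sub>R X2 - a6 *\<^sub>R X3" by (simp add: Y)
  then have X4: "X4 \<in> ?S" using Ys X1 X2 X3 by (metis span_diff span_scale)
  have span: "?S = UNIV"
    using span_mono[of "{X1, X2, X3, X4}" ?S] X1 X2 X3 X4 basis(3) by (simp add: span_span top_unique)
  \<comment> \<open>Orthogonality of the \<open>Y i\<close> under \<open>g0\<close> provides their
    coordinate forms directly.\<close>
  define e where "e i v = g0 (Y i) v / lam i" for i v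
  have lin: "linear (e i)" for i
    by (auto simp: e_def linear_iff inner_productD[OF g0] add_divide_distrib)
  \<comment> \<open>Modulo the central vectors \<open>X2\<close>, \<open>X3\<close>,
    \<open>Y 1\<close> is \<open>X1\<close> and \<open>Y 4\<close> is \<open>a4\<close> times
    \<open>X1\<close> plus \<open>X4\<close>, so their bracket is \<open>X2\<close>;
    \<open>Y 2\<close> and \<open>Y 3\<close> are central.\<close>
  have br_Y: "br (Y 1) (Y 1) = 0" "br (Y 1) (Y 2) = 0" "br (Y 1) (Y 3) = 0" "br (Y 1) (Y 4) = Y 2"
      "br (Y 2) (Y 1) = 0" "br (Y 2) (Y 2) = 0" "br (Y 2) (Y 3) = 0" "br (Y 2) (Y 4) = 0"
      "br (Y 3) (Y 1) = 0" "br (Y 3) (Y 2) = 0" "br (Y 3) (Y 3) = 0" "br (Y 3) (Y 4) = 0"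
      "br (Y 4) (Y 1) = - Y 2" "br (Y 4) (Y 2) = 0" "br (Y 4) (Y 3) = 0" "br (Y 4) (Y 4) = 0"
    by (simp_all add: Y br_simps brackets brX alt)
  have dual: "e 1 (Y 1) = 1" "e 1 (Y 2) = 0" "e 1 (Y 3) = 0" "e 1 (Y 4) = 0"
      "e 2 (Y 1) = 0" "e 2 (Y 2) = 1" "e 2 (Y 3) = 0" "e 2 (Y 4) = 0"
      "e 3 (Y 1) = 0" "e 3 (Y 2) = 0" "e 3 (Y 3) = 1" "e 3 (Y 4) = 0"
      "e 4 (Y 1) = 0" "e 4 (Y 2) = 0" "e 4 (Y 3) = 0" "e 4 (Y 4) = 1"
    using lam by (simp_all add: e_def diag)
  have fin: "finite {X1, X2, X3, X4}" by simp
  have frame: "heisenberg_frame br {X1, X2, X3, X4} (Y 1) (Y 2) (Y 3) (Y 4) (e 1) (e 2) (e 3) (e 4)"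
    by (rule heisenberg_frame.intro[OF bil fin basis(2,3) br_Y lin lin lin lin dual span])
  interpret heisenberg_diagonal br "{X1, X2, X3, X4}" "Y 1" "Y 2" "Y 3" "Y 4" "e 1" "e 2" "e 3" "e 4"
    "lam 1" "lam 2" "lam 3" "lam 4"
    by (rule heisenberg_diagonal.intro[OF frame heisenberg_diagonal_axioms.intro[OF lam]])
  have s0: "scale 0 = 1" by (simp add: scale_def)
  have "metric 0 u v = g0 u v" for u v
  proof (rule bilinear_frame_eqI)
    show "bilinear (metric 0)" "bilinear g0"
      using g0 inner_product_metric by (simp_all add: inner_product_def)
  qed (auto simp: metric_frame s0 dual diag)
  then have m0: "metric 0 = g0" by blast
  show ?thesis
    using ricci_flow_metric m0 ricci_flow_unique
    by (intro exI[of _ metric]) (auto simp: I4 metric_frame dual)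
qed

end
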